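(* Suppose $\mathbb{P}^*$ has independent components and bounded support. With probability (at least) $1-\alpha$ with respect to the sample, the family $\{\mathcal{U}^{FB}_\epsilon:0<\epsilon<1\}$ simultaneously implies a probabilistic guarantee for $\mathbb{P}^*$, where $$\mathcal{U}^{FB}_\epsilon=\Big\{\mathbf{y}_1+\mathbf{y}_2-\mathbf{y}_3:\ \mathbf{y}_1\in\mathbb{R}^d,\ \mathbf{y}_2,\mathbf{y}_3\in\mathbb{R}^d_+,\ \sum_{i=1}^d\Big(\frac{y_{2i}^2}{2\overline\sigma_{fi}^2}+\frac{y_{3i}^2}{2\overline\sigma_{bi}^2}\Big)\le\log(1/\epsilon),\ m_{bi}\le y_{1i}\le m_{fi},\ i=1,\dots,d\Big\}.$$ Moreover, $$\delta^*(\mathbf{v}\mid\mathcal{U}^{FB}_\epsilon)=\sum_{i:v_i\ge0}m_{fi}v_i+\sum_{i:v_i<0}m_{bi}v_i+\sqrt{2\log(1/\epsilon)\Big(\sum_{i:v_i\ge0}\overline\sigma_{fi}^2v_i^2+\sum_{i:v_i<0}\overline\sigma_{bi}^2v_i^2\Big)}.$$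
   Context: $0<\alpha<1$; $\mathcal{S}$ is a sample of $N$ points drawn i.i.d. from the unknown measure $\mathbb{P}^*$ on $\mathbb{R}^d$ with marginals $\mathbb{P}_i^*$; $\tilde{\mathbf{u}}$ is a random vector. For a univariate distribution $\mathbb{P}_i$ with mean $\mu_i$, the forward and backward deviations are $$\sigma_{fi}(\mathbb{P}_i)=\sup_{x>0}\sqrt{-\frac{2\mu_i}x+\frac2{x^2}\log\mathbb{E}^{\mathbb{P}_i}[e^{x\tilde u_i}]},\qquad\sigma_{bi}(\mathbb{P}_i)=\sup_{x>0}\sqrt{\frac{2\mu_i}x+\frac2{x^2}\log\mathbb{E}^{\mathbb{P}_i}[e^{-x\tilde u_i}]}.$$ From the data one computes thresholds $t_i\ge0$, $\overline\sigma_{fi}>0$, $\overline\sigma_{bi}>0$ of tests of, respectively, the hypotheses $\mathbb{E}^{\mathbb{P}^*_i}[\tilde u_i]=\mu_{0,i}$ (statistic $|\hat\mu_i-\mu_{0,i}|$, $\hat\mu_i$ the sample mean), $\sigma_{fi}(\mathbb{P}_i^* )\le\sigma_{0,fi}$ and $\sigma_{bi}(\mathbb{P}_i^* )\le\sigma_{0,bi}$, at significance levels $\alpha'/2,\alpha'/4,\alpha'/4$ with $\alpha'=1-\sqrt[d]{1-\alpha}$ (in the paper by the bootstrap). Set $m_{bi}=\hat\mu_i-t_i$, $m_{fi}=\hat\mu_i+t_i$, and $$\mathcal{P}_i^{FB}=\{\mathbb{P}_i:\ m_{bi}\le\mathbb{E}^{\mathbb{P}_i}[\tilde u_i]\le m_{fi},\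 \sigma_{fi}(\mathbb{P}_i)\le\overline\sigma_{fi},\ \sigma_{bi}(\mathbb{P}_i)\le\overline\sigma_{bi}\},\quad\mathcal{P}^{FB}=\{\mathbb{P}:\mathbb{P}_i\in\mathcal{P}_i^{FB},\ i=1,\dots,d\}.$$ Standing assumption: the combined test is valid at level $\alpha$, i.e. $\mathbb{P}^*\in\mathcal{P}^{FB}$ with probability at least $1-\alpha$ with respect to the sampling. $\delta^*(\mathbf{v}\mid\mathcal{U})=\sup_{\mathbf{u}\in\mathcal{U}}\mathbf{v}^T\mathbf{u}$. A set $\mathcal{U}$ implies a probabilistic guarantee for $\mathbb{P}^*$ at level $\epsilon$ if for every $\mathbf{x}^*\in\mathbb{R}^k$ and every real-valued $f(\mathbf{u},\mathbf{x})$ concave in $\mathbf{u}$ for all $\mathbf{x}$: $f(\mathbf{u},\mathbf{x}^* )\le0\ \forall\mathbf{u}\in\mathcal{U}$ implies $\mathbb{P}^*(f(\tilde{\mathbf{u}},\mathbf{x}^* )\le0)\ge1-\epsilon$. A family $\{\mathcal{U}_\epsilon:0<\epsilon<1\}$ simultaneously implies a probabilistic guarantee for $\mathbb{P}^*$ if for every $0<\epsilon<1$ the set $\mathcal{U}_\epsilon$ implies one at level $\epsilon$. *)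

theory Defs
  imports "HOL-Probability.Probability"
begin

definition marginal :: "(real^'d) measure \<Rightarrow> 'd \<Rightarrow> real measure" where
  "marginal P i = distr P borel (\<lambda>u. u $ i)"

definition independent_components :: "(real^'d) measure \<Rightarrow> bool" where
  "independent_components P \<longleftrightarrow>
     prob_space.indep_vars P (\<lambda>_. borel) (\<lambda>i u. u $ i) (UNIV :: 'd set)"

(* the support is the complement of the largest open null set *)
definition measure_support :: "'a::topological_space measure \<Rightarrow> 'a set" where
  "measure_support P = {u. \<forall>U. open U \<longrightarrow> u \<in> U \<longrightarrow> emeasure P U > 0}"

(* A sample is a function on {..<N}; its law is the N-fold product of P. *)
definition sample_measure :: "(real^'d) measure \<Rightarrow> nat \<Rightarrow> (nat \<Rightarrow> real^'d) measure" where
  "sample_measure P N = PiM {..<N} (\<lambda>_. P)"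

definition sample_mean :: "nat \<Rightarrow> (nat \<Rightarrow> real^'d) \<Rightarrow> real^'d" where
  "sample_mean N S = (1 / real N) *\<^sub>R (\<Sum>j<N. S j)"

(* Q need not be a measurable event; if it is, this says that its measure is at least p. *)
definition with_prob_at_least :: "'a measure \<Rightarrow> real \<Rightarrow> ('a \<Rightarrow> bool) \<Rightarrow> bool" where
  "with_prob_at_least M p Q \<longleftrightarrow>
     (\<exists>A \<in> sets M. measure M A \<ge> p \<and> (\<forall>\<omega>\<in>A. Q \<omega>))"

(* The deviations are extended reals: they are infinite when the supremum is infinite, and when
   some exponential moment is infinite (the Bochner integral of a non-integrable function would
   be 0). For a mean that exists, the argument of the square root is nonnegative by Jensen. *)
definition forward_deviation :: "real measure \<Rightarrow> ereal" where
  "forward_deviation Q =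
     (SUP x\<in>{0<..}.
        if integrable Q (\<lambda>u. exp (x * u))
        then ereal (sqrt (- (2 * (\<integral>u. u \<partial>Q)) / x + 2 / x\<^sup>2 * ln (\<integral>u. exp (x * u) \<partial>Q)))
        else \<infinity>)"

definition backward_deviation :: "real measure \<Rightarrow> ereal" where
  "backward_deviation Q =
     (SUP x\<in>{0<..}.
        if integrable Q (\<lambda>u. exp (- x * u))
        then ereal (sqrt (2 * (\<integral>u. u \<partial>Q) / x + 2 / x\<^sup>2 * ln (\<integral>u. exp (- x * u) \<partial>Q)))
        else \<infinity>)"

definition P_FB_marginal :: "real \<Rightarrow> real \<Rightarrow> real \<Rightarrow> real \<Rightarrow> real measure set" where
  "P_FB_marginal mb mf \<sigma>f \<sigma>b =
     {Q. prob_space Q \<and> sets Q = sets borel \<and> integrable Q (\<lambda>u. u) \<and>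
         mb \<le> (\<integral>u. u \<partial>Q) \<and> (\<integral>u. u \<partial>Q) \<le> mf \<and>
         forward_deviation Q \<le> ereal \<sigma>f \<and> backward_deviation Q \<le> ereal \<sigma>b}"

definition P_FB :: "real^'d \<Rightarrow> real^'d \<Rightarrow> real^'d \<Rightarrow> real^'d \<Rightarrow> (real^'d) measure set" where
  "P_FB mb mf \<sigma>f \<sigma>b =
     {P. prob_space P \<and> sets P = sets borel \<and>
         (\<forall>i. marginal P i \<in> P_FB_marginal (mb $ i) (mf $ i) (\<sigma>f $ i) (\<sigma>b $ i))}"

definition U_FB ::
  "real^'d \<Rightarrow> real^'d \<Rightarrow> real^'d \<Rightarrow> real^'d \<Rightarrow> real \<Rightarrow> (real^'d) set" where
  "U_FB mb mf \<sigma>f \<sigma>b \<epsilon> =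
     {y1 + y2 - y3 | y1 y2 y3.
        (\<forall>i. 0 \<le> y2 $ i \<and> 0 \<le> y3 $ i) \<and>
        (\<Sum>i\<in>UNIV. (y2 $ i)\<^sup>2 / (2 * (\<sigma>f $ i)\<^sup>2) + (y3 $ i)\<^sup>2 / (2 * (\<sigma>b $ i)\<^sup>2)) \<le> ln (1 / \<epsilon>) \<and>
        (\<forall>i. mb $ i \<le> y1 $ i \<and> y1 $ i \<le> mf $ i)}"

definition support_function :: "'a::real_inner \<Rightarrow> 'a set \<Rightarrow> ereal" where
  "support_function v U = (SUP u\<in>U. ereal (v \<bullet> u))"

(* The type argument fixes the space of the decision variable x. *)
definition implies_guarantee ::
  "'k::finite itself \<Rightarrow> (real^'d) measure \<Rightarrow> real \<Rightarrow> (real^'d) set \<Rightarrow> bool" where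
  "implies_guarantee K P \<epsilon> U \<longleftrightarrow>
     (\<forall>(x0 :: real^'k) (f :: real^'d \<Rightarrow> real^'k \<Rightarrow> real).
        (\<forall>x. concave_on UNIV (\<lambda>u. f u x)) \<longrightarrow>
        (\<forall>u\<in>U. f u x0 \<le> 0) \<longrightarrow>
        measure P {u \<in> space P. f u x0 \<le> 0} \<ge> 1 - \<epsilon>)"

definition simultaneously_implies_guarantee ::
  "'k::finite itself \<Rightarrow> (real^'d) measure \<Rightarrow> (real \<Rightarrow> (real^'d) set) \<Rightarrow> bool" where
  "simultaneously_implies_guarantee K P U \<longleftrightarrow>
     (\<forall>\<epsilon>. 0 < \<epsilon> \<and> \<epsilon> < 1 \<longrightarrow> implies_guarantee K P \<epsilon> (U \<epsilon>))"

end

theory Submission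
  imports Defs
begin

text \<open>
  Write \<open>L = ln (1 / \<epsilon>)\<close>. A bound \<open>\<sigma>\<close> on a forward or backward deviation says exactly that the
  moment generating function of the marginal is dominated, on one half line, by that of a normal
  law with the same mean and standard deviation \<open>\<sigma>\<close>. For independent components these bounds
  multiply, so for every direction \<open>v\<close> the linear form \<open>v \<bullet> u\<close> has a moment generating
  function below \<open>exp (M + V / 2)\<close>, where \<open>M\<close> is the largest mean of \<open>v \<bullet> u\<close> compatible with the
  confidence intervals and \<open>V\<close> is the variance proxy \<open>\<Sum> s\<^sub>i\<^sup>2 v\<^sub>i\<^sup>2\<close>, the sign of \<open>v\<^sub>i\<close> choosing the
  forward or the backward deviation \<open>s\<^sub>i\<close> (\<open>mgf_linear_form_le\<close>). Chernoff's inequality with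
  the optimal multiplier \<open>sqrt (2 * L / V)\<close> shows that \<open>v \<bullet> u\<close> reaches \<open>M + sqrt (2 * L * V)\<close>
  with probability at most \<open>\<epsilon>\<close> (\<open>prob_linear_form_ge\<close>).

  The same number is the support function of the uncertainty set in direction \<open>v\<close>: the quadratic
  constraint is an ellipsoid, and the bound is the Cauchy--Schwarz inequality, attained by a
  multiple of \<open>s\<^sub>i\<^sup>2 v\<^sub>i\<close> (\<open>inner_U_FB_le\<close>, \<open>U_FB_maximizer\<close>).

  Half spaces suffice because of convexity. If a concave \<open>f\<close> is nonpositive on the convex
  uncertainty set, then \<open>{f > 0}\<close> is a convex set disjoint from it, and a separating hyperplane
  puts \<open>{f > 0}\<close> inside a half space beyond the support function (\<open>guarantee_U_FB\<close>). The
  argument applies to every sample for which \<open>P\<close> passes the tests and to all \<open>\<epsilon>\<close> at once,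
  so it applies with at least the probability that \<open>P\<close> passes.
\<close>

section \<open>Support values in a direction\<close>

text \<open>Here \<open>b\<close> is a coordinate of the direction; its sign decides which of the two one-sided data
  \<open>pos\<close>, \<open>neg\<close> of the corresponding marginal is the binding one.\<close>

definition by_sign :: "real \<Rightarrow> real \<Rightarrow> real \<Rightarrow> real" where
  "by_sign b pos neg = (if 0 \<le> b then pos else neg)"

definition worst_mean :: "real^'d \<Rightarrow> real^'d \<Rightarrow> real^'d \<Rightarrow> real" where
  "worst_mean mb mf v = (\<Sum>i\<in>UNIV. by_sign (v $ i) (mf $ i) (mb $ i) * v $ i)"

definition variance_proxy :: "real^'d \<Rightarrow> real^'d \<Rightarrow> real^'d \<Rightarrow> real" where
  "variance_proxy \<sigma>f \<sigma>b v = (\<Sum>i\<in>UNIV. (by_sign (v $ i) (\<sigma>f $ i) (\<sigma>b $ i))\<^sup>2 * (v $ i)\<^sup>2)"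

definition FB_support_value ::
  "real^'d \<Rightarrow> real^'d \<Rightarrow> real^'d \<Rightarrow> real^'d \<Rightarrow> real \<Rightarrow> real^'d \<Rightarrow> real" where
  "FB_support_value mb mf \<sigma>f \<sigma>b \<epsilon> v =
     worst_mean mb mf v + sqrt (2 * ln (1 / \<epsilon>) * variance_proxy \<sigma>f \<sigma>b v)"

lemma by_sign_pos_mult: "0 < c \<Longrightarrow> by_sign (c * b) p n = by_sign b p n"
  by (simp add: by_sign_def zero_le_mult_iff)

lemma by_sign_pos: "0 < p \<Longrightarrow> 0 < n \<Longrightarrow> 0 < by_sign b p n"
  by (simp add: by_sign_def)

lemma worst_mean_scaleR: "0 < c \<Longrightarrow> worst_mean mb mf (c *\<^sub>R v) = c * worst_mean mb mf v"
  by (simp add: worst_mean_def by_sign_pos_mult sum_distrib_left algebra_simps)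

lemma variance_proxy_scaleR:
  "0 < c \<Longrightarrow> variance_proxy \<sigma>f \<sigma>b (c *\<^sub>R v) = c\<^sup>2 * variance_proxy \<sigma>f \<sigma>b v"
  by (simp add: variance_proxy_def by_sign_pos_mult sum_distrib_left power_mult_distrib algebra_simps)

lemma variance_proxy_nonneg: "0 \<le> variance_proxy \<sigma>f \<sigma>b v"
  by (simp add: variance_proxy_def sum_nonneg)

lemma variance_proxy_pos:
  assumes "\<And>i. 0 < \<sigma>f $ i" "\<And>i. 0 < \<sigma>b $ i" "v \<noteq> 0"
  shows "0 < variance_proxy \<sigma>f \<sigma>b v"
proof -
  obtain i where "v $ i \<noteq> 0"
    using \<open>v \<noteq> 0\<close> by (auto simp: vec_eq_iff)
  moreover have "0 < by_sign (v $ i) (\<sigma>f $ i) (\<sigma>b $ i)"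
    using assms by (intro by_sign_pos)
  ultimately show ?thesis
    unfolding variance_proxy_def by (intro sum_pos2[of UNIV i]) auto
qed

lemma sum_by_sign:
  fixes v :: "real^'d" and g :: "'d \<Rightarrow> real \<Rightarrow> real"
  shows "(\<Sum>i\<in>UNIV. g i (by_sign (v $ i) (p $ i) (n $ i))) =
         (\<Sum>i | 0 \<le> v $ i. g i (p $ i)) + (\<Sum>i | v $ i < 0. g i (n $ i))"
proof -
  have "- {i. 0 \<le> v $ i} = {i. v $ i < 0}"
    by auto
  then show ?thesis
    by (simp add: by_sign_def if_distrib[of "g _"] sum.If_cases)
qed

lemma FB_support_value_eq:
  "FB_support_value mb mf \<sigma>f \<sigma>b \<epsilon> v =
     (\<Sum>i | 0 \<le> v $ i. mf $ i * v $ i) + (\<Sum>i | v $ i < 0. mb $ i * v $ i) +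
     sqrt (2 * ln (1 / \<epsilon>) *
       ((\<Sum>i | 0 \<le> v $ i. (\<sigma>f $ i)\<^sup>2 * (v $ i)\<^sup>2) + (\<Sum>i | v $ i < 0. (\<sigma>b $ i)\<^sup>2 * (v $ i)\<^sup>2)))"
  unfolding FB_support_value_def worst_mean_def variance_proxy_def
  by (simp only: sum_by_sign[of "\<lambda>i x. x * v $ i"] sum_by_sign[of "\<lambda>i x. x\<^sup>2 * (v $ i)\<^sup>2"])

section \<open>The uncertainty set\<close>

lemma square_convex_combination:
  fixes a b p q :: real
  assumes "0 \<le> p" "0 \<le> q" "p + q = 1"
  shows "(p * a + q * b)\<^sup>2 \<le> p * a\<^sup>2 + q * b\<^sup>2"
proof -
  have "p * a\<^sup>2 + q * b\<^sup>2 - (p * a + q * b)\<^sup>2 = p * q * (a - b)\<^sup>2"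
    using \<open>p + q = 1\<close> by algebra
  with assms show ?thesis
    by (smt (verit) mult_nonneg_nonneg zero_le_power2)
qed

lemma convex_U_FB:
  fixes mb mf \<sigma>f \<sigma>b :: "real^'d"
  shows "convex (U_FB mb mf \<sigma>f \<sigma>b \<epsilon>)"
proof (rule convexI)
  fix u w :: "real^'d" and p q :: real
  assume u: "u \<in> U_FB mb mf \<sigma>f \<sigma>b \<epsilon>" and w: "w \<in> U_FB mb mf \<sigma>f \<sigma>b \<epsilon>"
    and pq: "0 \<le> p" "0 \<le> q" "p + q = 1"
  let ?E = "\<lambda>y z :: real^'d.
    \<Sum>i\<in>UNIV. (y $ i)\<^sup>2 / (2 * (\<sigma>f $ i)\<^sup>2) + (z $ i)\<^sup>2 / (2 * (\<sigma>b $ i)\<^sup>2)"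
  obtain y1 y2 y3 where y: "u = y1 + y2 - y3" "\<And>i. 0 \<le> y2 $ i" "\<And>i. 0 \<le> y3 $ i"
    "?E y2 y3 \<le> ln (1 / \<epsilon>)" "\<And>i. mb $ i \<le> y1 $ i" "\<And>i. y1 $ i \<le> mf $ i"
    using u unfolding U_FB_def by blast
  obtain z1 z2 z3 where z: "w = z1 + z2 - z3" "\<And>i. 0 \<le> z2 $ i" "\<And>i. 0 \<le> z3 $ i"
    "?E z2 z3 \<le> ln (1 / \<epsilon>)" "\<And>i. mb $ i \<le> z1 $ i" "\<And>i. z1 $ i \<le> mf $ i"
    using w unfolding U_FB_def by blast
  let ?c = "\<lambda>a b :: real^'d. p *\<^sub>R a + q *\<^sub>R b"
  have sq: "(?c a b $ i)\<^sup>2 / (2 * s\<^sup>2) \<le> p * ((a $ i)\<^sup>2 / (2 * s\<^sup>2)) + q * ((b $ i)\<^sup>2 / (2 * s\<^sup>2))"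
    for a b i and s :: real
    using divide_right_mono[OF square_convex_combination[OF pq, of "a $ i" "b $ i"], of "2 * s\<^sup>2"]
    by (simp add: add_divide_distrib)
  have "?E (?c y2 z2) (?c y3 z3) \<le> (\<Sum>i\<in>UNIV.
      p * ((y2 $ i)\<^sup>2 / (2 * (\<sigma>f $ i)\<^sup>2) + (y3 $ i)\<^sup>2 / (2 * (\<sigma>b $ i)\<^sup>2)) +
      q * ((z2 $ i)\<^sup>2 / (2 * (\<sigma>f $ i)\<^sup>2) + (z3 $ i)\<^sup>2 / (2 * (\<sigma>b $ i)\<^sup>2)))"
    by (intro sum_mono order.trans[OF add_mono[OF sq sq]]) (simp add: algebra_simps)
  also have "\<dots> = p * ?E y2 y3 + q * ?E z2 z3"
    by (subst sum.distrib) (simp only: sum_distrib_left)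
  also have "\<dots> \<le> ln (1 / \<epsilon>)"
    using y(4) z(4) pq by (intro convex_bound_le)
  finally have E: "?E (?c y2 z2) (?c y3 z3) \<le> ln (1 / \<epsilon>)" .
  have lower: "m \<le> ?c a b $ i" if "m \<le> a $ i" "m \<le> b $ i" for a b i m
    using convex_bound_le[of "- (a $ i)" "- m" "- (b $ i)" p q] that pq by simp
  have upper: "?c a b $ i \<le> m" if "a $ i \<le> m" "b $ i \<le> m" for a b i m
    using convex_bound_le[of "a $ i" m "b $ i" p q] that pq by simp
  have "p *\<^sub>R u + q *\<^sub>R w = ?c y1 z1 + ?c y2 z2 - ?c y3 z3"
    by (simp add: y(1) z(1) algebra_simps)
  then show "p *\<^sub>R u + q *\<^sub>R w \<in> U_FB mb mf \<sigma>f \<sigma>b \<epsilon>"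
    unfolding U_FB_def using E lower[OF y(2) z(2)] lower[OF y(3) z(3)]
      lower[OF y(5) z(5)] upper[OF y(6) z(6)]
    by blast
qed

text \<open>In each coordinate only one of \<open>y2\<close>, \<open>y3\<close> helps to increase \<open>v \<bullet> u\<close>; dividing it by the
  matching deviation turns the quadratic constraint into a Euclidean ball of radius
  \<open>sqrt (2 * ln (1 / \<epsilon>))\<close>, on which the Cauchy--Schwarz inequality bounds the linear form.\<close>

lemma inner_U_FB_le:
  assumes \<sigma>: "\<And>i. 0 < \<sigma>f $ i" "\<And>i. 0 < \<sigma>b $ i"
    and u: "u \<in> U_FB mb mf \<sigma>f \<sigma>b \<epsilon>"
  shows "v \<bullet> u \<le> FB_support_value mb mf \<sigma>f \<sigma>b \<epsilon> v"
proof -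
  obtain y1 y2 y3 where y: "u = y1 + y2 - y3" "\<And>i. 0 \<le> y2 $ i" "\<And>i. 0 \<le> y3 $ i"
    "(\<Sum>i\<in>UNIV. (y2 $ i)\<^sup>2 / (2 * (\<sigma>f $ i)\<^sup>2) + (y3 $ i)\<^sup>2 / (2 * (\<sigma>b $ i)\<^sup>2)) \<le> ln (1 / \<epsilon>)"
    "\<And>i. mb $ i \<le> y1 $ i" "\<And>i. y1 $ i \<le> mf $ i"
    using u unfolding U_FB_def by blast
  define s where "s i = by_sign (v $ i) (\<sigma>f $ i) (\<sigma>b $ i)" for i
  define w where "w i = by_sign (v $ i) (y2 $ i) (y3 $ i)" for i
  have s_pos: "0 < s i" for i
    unfolding s_def using \<sigma> by (intro by_sign_pos)
  have "v $ i \<bullet> y1 $ i \<le> by_sign (v $ i) (mf $ i) (mb $ i) * v $ i" for i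
    using mult_left_mono[OF y(6), of "v $ i" i] mult_left_mono_neg[OF y(5), of "v $ i" i]
    by (simp add: by_sign_def mult.commute)
  then have mean: "v \<bullet> y1 \<le> worst_mean mb mf v"
    unfolding inner_vec_def worst_mean_def by (intro sum_mono)
  have "v \<bullet> (y2 - y3) \<le> (\<Sum>i\<in>UNIV. (s i * \<bar>v $ i\<bar>) * (w i / s i))"
    unfolding inner_vec_def
  proof (intro sum_mono)
    fix i
    have "v $ i * (y2 $ i - y3 $ i) \<le> \<bar>v $ i\<bar> * w i"
      using y(2,3)[of i] by (simp add: w_def by_sign_def algebra_simps mult_nonpos_nonneg)
    then show "v $ i \<bullet> (y2 - y3) $ i \<le> (s i * \<bar>v $ i\<bar>) * (w i / s i)"
      using s_pos[of i] by simp
  qed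
  also have "\<dots> \<le> sqrt ((\<Sum>i\<in>UNIV. (s i * \<bar>v $ i\<bar>)\<^sup>2) * (\<Sum>i\<in>UNIV. (w i / s i)\<^sup>2))"
    by (intro real_le_rsqrt Cauchy_Schwarz_ineq_sum)
  also have "(\<Sum>i\<in>UNIV. (s i * \<bar>v $ i\<bar>)\<^sup>2) = variance_proxy \<sigma>f \<sigma>b v"
    by (simp add: variance_proxy_def s_def power_mult_distrib)
  also have "sqrt (variance_proxy \<sigma>f \<sigma>b v * (\<Sum>i\<in>UNIV. (w i / s i)\<^sup>2)) \<le>
             sqrt (variance_proxy \<sigma>f \<sigma>b v * (2 * ln (1 / \<epsilon>)))"
  proof -
    have "(\<Sum>i\<in>UNIV. (w i / s i)\<^sup>2) \<le>
        (\<Sum>i\<in>UNIV. 2 * ((y2 $ i)\<^sup>2 / (2 * (\<sigma>f $ i)\<^sup>2) + (y3 $ i)\<^sup>2 / (2 * (\<sigma>b $ i)\<^sup>2)))"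
      by (intro sum_mono) (simp add: w_def s_def by_sign_def power_divide)
    also have "\<dots> \<le> 2 * ln (1 / \<epsilon>)"
      using y(4) by (simp only: flip: sum_distrib_left)
    finally show ?thesis
      by (intro real_sqrt_le_mono mult_left_mono variance_proxy_nonneg)
  qed
  finally have "v \<bullet> (y2 - y3) \<le> sqrt (2 * ln (1 / \<epsilon>) * variance_proxy \<sigma>f \<sigma>b v)"
    by (simp add: mult.commute)
  moreover have "v \<bullet> u = v \<bullet> y1 + v \<bullet> (y2 - y3)"
    by (simp add: y(1) inner_simps)
  ultimately show ?thesis
    using mean by (simp add: FB_support_value_def)
qed

lemma U_FB_maximizer:
  fixes mb mf \<sigma>f \<sigma>b :: "real^'d"
  assumes \<sigma>: "\<And>i. 0 < \<sigma>f $ i" "\<And>i. 0 < \<sigma>b $ i"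
    and m: "\<And>i. mb $ i \<le> mf $ i" and \<epsilon>: "0 < \<epsilon>" "\<epsilon> < 1"
  obtains u where "u \<in> U_FB mb mf \<sigma>f \<sigma>b \<epsilon>" "v \<bullet> u = FB_support_value mb mf \<sigma>f \<sigma>b \<epsilon> v"
proof
  let ?L = "ln (1 / \<epsilon>)" and ?V = "variance_proxy \<sigma>f \<sigma>b v"
  have L: "0 \<le> ?L"
    using \<epsilon> by simp
  \<comment> \<open>The equality case of Cauchy--Schwarz, scaled to make the quadratic constraint tight. For
      \<open>v = 0\<close>, where every point is a maximizer, division by zero makes the multiplier \<open>0\<close>.\<close>
  define l where "l = sqrt (2 * ?L / ?V)"
  define y1 :: "real^'d" where "y1 = (\<chi> i. by_sign (v $ i) (mf $ i) (mb $ i))"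
  define y2 :: "real^'d" where "y2 = (\<chi> i. by_sign (v $ i) (l * (\<sigma>f $ i)\<^sup>2 * v $ i) 0)"
  define y3 :: "real^'d" where "y3 = (\<chi> i. by_sign (v $ i) 0 (- l * (\<sigma>b $ i)\<^sup>2 * v $ i))"
  have l: "0 \<le> l"
    using L variance_proxy_nonneg[of \<sigma>f \<sigma>b v] by (simp add: l_def)
  have l2: "l\<^sup>2 = 2 * ?L / ?V"
    using L variance_proxy_nonneg[of \<sigma>f \<sigma>b v] by (simp add: l_def)
  have "(\<Sum>i\<in>UNIV. (y2 $ i)\<^sup>2 / (2 * (\<sigma>f $ i)\<^sup>2) + (y3 $ i)\<^sup>2 / (2 * (\<sigma>b $ i)\<^sup>2)) =
        (\<Sum>i\<in>UNIV. l\<^sup>2 / 2 * ((by_sign (v $ i) (\<sigma>f $ i) (\<sigma>b $ i))\<^sup>2 * (v $ i)\<^sup>2))"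
    (is "?E = _")
  proof (intro sum.cong refl)
    fix i
    show "(y2 $ i)\<^sup>2 / (2 * (\<sigma>f $ i)\<^sup>2) + (y3 $ i)\<^sup>2 / (2 * (\<sigma>b $ i)\<^sup>2) =
          l\<^sup>2 / 2 * ((by_sign (v $ i) (\<sigma>f $ i) (\<sigma>b $ i))\<^sup>2 * (v $ i)\<^sup>2)"
      using \<sigma>[of i] by (simp add: y2_def y3_def by_sign_def field_simps power2_eq_square)
  qed
  also have "\<dots> = l\<^sup>2 / 2 * ?V"
    by (simp only: variance_proxy_def sum_distrib_left)
  also have "\<dots> \<le> ?L"
    using L by (simp add: l2)
  finally have E: "?E \<le> ?L" .
  have "\<forall>i. 0 \<le> y2 $ i \<and> 0 \<le> y3 $ i"
    using l by (auto simp: y2_def y3_def by_sign_def intro!: mult_nonneg_nonpos)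
  moreover have "\<forall>i. mb $ i \<le> y1 $ i \<and> y1 $ i \<le> mf $ i"
    using m by (simp add: y1_def by_sign_def)
  ultimately show "y1 + y2 - y3 \<in> U_FB mb mf \<sigma>f \<sigma>b \<epsilon>"
    unfolding U_FB_def using E by blast
  have "v \<bullet> (y2 - y3) = (\<Sum>i\<in>UNIV. l * ((by_sign (v $ i) (\<sigma>f $ i) (\<sigma>b $ i))\<^sup>2 * (v $ i)\<^sup>2))"
    unfolding inner_vec_def
    by (intro sum.cong refl) (simp add: y2_def y3_def by_sign_def power2_eq_square)
  also have "\<dots> = l * ?V"
    by (simp only: variance_proxy_def sum_distrib_left)
  also have "\<dots> = sqrt (2 * ?L * ?V)"
  proof -
    have "(l * ?V)\<^sup>2 = 2 * ?L * ?V"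
      using variance_proxy_nonneg[of \<sigma>f \<sigma>b v]
      by (simp add: power_mult_distrib l2) (simp add: power2_eq_square)
    then show ?thesis
      using l variance_proxy_nonneg[of \<sigma>f \<sigma>b v] by (metis real_sqrt_unique mult_nonneg_nonneg)
  qed
  moreover have "v \<bullet> y1 = worst_mean mb mf v"
    by (simp add: inner_vec_def worst_mean_def y1_def mult.commute)
  ultimately show "v \<bullet> (y1 + y2 - y3) = FB_support_value mb mf \<sigma>f \<sigma>b \<epsilon> v"
    by (simp add: FB_support_value_def inner_simps)
qed

lemma support_function_U_FB:
  assumes "\<And>i. 0 < \<sigma>f $ i" "\<And>i. 0 < \<sigma>b $ i" "\<And>i. mb $ i \<le> mf $ i" "0 < \<epsilon>" "\<epsilon> < 1"
  shows "support_function v (U_FB mb mf \<sigma>f \<sigma>b \<epsilon>) = ereal (FB_support_value mb mf \<sigma>f \<sigma>b \<epsilon> v)"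
proof -
  obtain u where "u \<in> U_FB mb mf \<sigma>f \<sigma>b \<epsilon>" "v \<bullet> u = FB_support_value mb mf \<sigma>f \<sigma>b \<epsilon> v"
    using U_FB_maximizer assms by blast
  moreover have "v \<bullet> u \<le> FB_support_value mb mf \<sigma>f \<sigma>b \<epsilon> v" if "u \<in> U_FB mb mf \<sigma>f \<sigma>b \<epsilon>" for u
    using inner_U_FB_le assms(1,2) that by blast
  ultimately show ?thesis
    unfolding support_function_def by (intro antisym SUP_least SUP_upper2) auto
qed

section \<open>Moment generating functions\<close>

lemma le_exp_of_deviation_le:
  fixes x \<mu> m \<sigma> :: real
  assumes "0 < x" "sqrt (- (2 * \<mu>) / x + 2 / x\<^sup>2 * ln m) \<le> \<sigma>"
  shows "m \<le> exp (x * \<mu> + x\<^sup>2 * \<sigma>\<^sup>2 / 2)"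
proof (cases "0 < m")
  case True
  have "- (2 * \<mu>) / x + 2 / x\<^sup>2 * ln m \<le> \<sigma>\<^sup>2"
    using assms(2) by (rule sqrt_le_D)
  then have "x\<^sup>2 / 2 * (- (2 * \<mu>) / x + 2 / x\<^sup>2 * ln m) \<le> x\<^sup>2 / 2 * \<sigma>\<^sup>2"
    by (rule mult_left_mono) simp
  moreover have "x\<^sup>2 / 2 * (- (2 * \<mu>) / x + 2 / x\<^sup>2 * ln m) = ln m - x * \<mu>"
    using \<open>0 < x\<close> by (simp add: field_simps power2_eq_square)
  ultimately have "ln m \<le> x * \<mu> + x\<^sup>2 * \<sigma>\<^sup>2 / 2"
    by simp
  then show ?thesis
    using True by (metis exp_le_cancel_iff exp_ln)
next
  case False
  then show ?thesis
    by (meson exp_ge_zero not_less order.trans)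
qed

lemma mgf_le_of_forward_deviation_le:
  assumes "forward_deviation Q \<le> ereal \<sigma>" "0 < x"
  shows "integrable Q (\<lambda>u. exp (x * u))"
    and "(\<integral>u. exp (x * u) \<partial>Q) \<le> exp (x * (\<integral>u. u \<partial>Q) + x\<^sup>2 * \<sigma>\<^sup>2 / 2)"
proof -
  have *: "(if integrable Q (\<lambda>u. exp (x * u))
        then ereal (sqrt (- (2 * (\<integral>u. u \<partial>Q)) / x + 2 / x\<^sup>2 * ln (\<integral>u. exp (x * u) \<partial>Q)))
        else \<infinity>) \<le> ereal \<sigma>"
    using assms unfolding forward_deviation_def SUP_le_iff by simp
  then show "integrable Q (\<lambda>u. exp (x * u))"
    by (auto split: if_splits)
  with * show "(\<integral>u. exp (x * u) \<partial>Q) \<le> exp (x * (\<integral>u. u \<partial>Q) + x\<^sup>2 * \<sigma>\<^sup>2 / 2)"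
    using \<open>0 < x\<close> by (intro le_exp_of_deviation_le) auto
qed

lemma mgf_le_of_backward_deviation_le:
  assumes "backward_deviation Q \<le> ereal \<sigma>" "0 < x"
  shows "integrable Q (\<lambda>u. exp (- x * u))"
    and "(\<integral>u. exp (- x * u) \<partial>Q) \<le> exp (- x * (\<integral>u. u \<partial>Q) + x\<^sup>2 * \<sigma>\<^sup>2 / 2)"
proof -
  have *: "(if integrable Q (\<lambda>u. exp (- x * u))
        then ereal (sqrt (2 * (\<integral>u. u \<partial>Q) / x + 2 / x\<^sup>2 * ln (\<integral>u. exp (- x * u) \<partial>Q)))
        else \<infinity>) \<le> ereal \<sigma>"
    using assms unfolding backward_deviation_def SUP_le_iff by simp
  then show int: "integrable Q (\<lambda>u. exp (- x * u))"
    by (auto split: if_splits)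
  have "(\<integral>u. exp (- x * u) \<partial>Q) \<le> exp (x * - (\<integral>u. u \<partial>Q) + x\<^sup>2 * \<sigma>\<^sup>2 / 2)"
    using \<open>0 < x\<close> * int by (intro le_exp_of_deviation_le) auto
  then show "(\<integral>u. exp (- x * u) \<partial>Q) \<le> exp (- x * (\<integral>u. u \<partial>Q) + x\<^sup>2 * \<sigma>\<^sup>2 / 2)"
    by simp
qed

lemma mgf_marginal_le:
  assumes Q: "Q \<in> P_FB_marginal mb mf \<sigma>f \<sigma>b"
  shows "integrable Q (\<lambda>u. exp (z * u))"
    and "(\<integral>u. exp (z * u) \<partial>Q) \<le> exp (by_sign z mf mb * z + (by_sign z \<sigma>f \<sigma>b)\<^sup>2 * z\<^sup>2 / 2)"
proof -
  interpret prob_space Q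
    using Q by (simp add: P_FB_marginal_def)
  have mean: "mb \<le> (\<integral>u. u \<partial>Q)" "(\<integral>u. u \<partial>Q) \<le> mf"
    and dev: "forward_deviation Q \<le> ereal \<sigma>f" "backward_deviation Q \<le> ereal \<sigma>b"
    using Q by (simp_all add: P_FB_marginal_def)
  consider "z = 0" | "0 < z" | "z < 0"
    by linarith
  then have "integrable Q (\<lambda>u. exp (z * u)) \<and>
    (\<integral>u. exp (z * u) \<partial>Q) \<le> exp (by_sign z mf mb * z + (by_sign z \<sigma>f \<sigma>b)\<^sup>2 * z\<^sup>2 / 2)"
  proof cases
    case 1
    then show ?thesis
      by (simp add: prob_space)
  next
    case 2
    note mgf = mgf_le_of_forward_deviation_le[OF dev(1) 2]
    have "z * (\<integral>u. u \<partial>Q) \<le> z * mf"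
      using mean 2 by (intro mult_left_mono) auto
    then have "exp (z * (\<integral>u. u \<partial>Q) + z\<^sup>2 * \<sigma>f\<^sup>2 / 2) \<le> exp (mf * z + \<sigma>f\<^sup>2 * z\<^sup>2 / 2)"
      by (simp add: mult.commute)
    from order.trans[OF mgf(2) this] show ?thesis
      using mgf(1) 2 by (simp add: by_sign_def)
  next
    case 3
    then have "0 < - z"
      by simp
    note mgf = mgf_le_of_backward_deviation_le[OF dev(2) this, unfolded minus_minus power2_minus]
    have "z * (\<integral>u. u \<partial>Q) \<le> z * mb"
      using mean 3 by (intro mult_left_mono_neg) auto
    then have "exp (z * (\<integral>u. u \<partial>Q) + z\<^sup>2 * \<sigma>b\<^sup>2 / 2) \<le> exp (mb * z + \<sigma>b\<^sup>2 * z\<^sup>2 / 2)"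
      by (simp add: mult.commute)
    from order.trans[OF mgf(2) this] show ?thesis
      using mgf(1) 3 by (simp add: by_sign_def)
  qed
  then show "integrable Q (\<lambda>u. exp (z * u))"
    and "(\<integral>u. exp (z * u) \<partial>Q) \<le> exp (by_sign z mf mb * z + (by_sign z \<sigma>f \<sigma>b)\<^sup>2 * z\<^sup>2 / 2)"
    by simp_all
qed

text \<open>Independence factors the moment generating function of \<open>v \<bullet> u\<close> over the coordinates.\<close>

lemma mgf_linear_form_le:
  fixes P :: "(real^'d) measure"
  assumes ind: "independent_components P"
    and P: "P \<in> P_FB mb mf \<sigma>f \<sigma>b"
  shows "integrable P (\<lambda>u. exp (v \<bullet> u))"
    and "(\<integral>u. exp (v \<bullet> u) \<partial>P) \<le> exp (worst_mean mb mf v + variance_proxy \<sigma>f \<sigma>b v / 2)"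
proof -
  interpret prob_space P
    using P by (simp add: P_FB_def)
  have sets_P: "sets P = sets borel"
    using P by (simp add: P_FB_def)
  have marg: "marginal P i \<in> P_FB_marginal (mb $ i) (mf $ i) (\<sigma>f $ i) (\<sigma>b $ i)" for i
    using P by (simp add: P_FB_def)
  have coord [measurable]: "(\<lambda>u. u $ i) \<in> borel_measurable P" for i
    unfolding measurable_cong_sets[OF sets_P refl]
    by (intro borel_measurable_continuous_onI continuous_intros)
  have indep: "indep_vars (\<lambda>_. borel) (\<lambda>i u. exp (v $ i * u $ i)) UNIV"
    using ind unfolding independent_components_def
    by (rule indep_vars_compose2) measurable
  have int: "integrable P (\<lambda>u. exp (v $ i * u $ i))" for i
    using mgf_marginal_le(1)[OF marg, of i "v $ i"]
    by (simp add: marginal_def integrable_distr_eq)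
  have le: "(\<integral>u. exp (v $ i * u $ i) \<partial>P) \<le>
      exp (by_sign (v $ i) (mf $ i) (mb $ i) * v $ i +
           (by_sign (v $ i) (\<sigma>f $ i) (\<sigma>b $ i))\<^sup>2 * (v $ i)\<^sup>2 / 2)" for i
    using mgf_marginal_le(2)[OF marg, of i "v $ i"]
    by (simp add: marginal_def integral_distr)
  have factor: "exp (v \<bullet> u) = (\<Prod>i\<in>UNIV. exp (v $ i * u $ i))" for u
    by (simp add: inner_vec_def exp_sum)
  show "integrable P (\<lambda>u. exp (v \<bullet> u))"
    unfolding factor by (rule indep_vars_integrable[OF finite indep int])
  have "(\<integral>u. exp (v \<bullet> u) \<partial>P) = (\<Prod>i\<in>UNIV. \<integral>u. exp (v $ i * u $ i) \<partial>P)"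
    unfolding factor by (rule indep_vars_lebesgue_integral[OF finite indep int])
  also have "\<dots> \<le> (\<Prod>i\<in>UNIV. exp (by_sign (v $ i) (mf $ i) (mb $ i) * v $ i +
           (by_sign (v $ i) (\<sigma>f $ i) (\<sigma>b $ i))\<^sup>2 * (v $ i)\<^sup>2 / 2))"
    using le by (intro prod_mono) auto
  also have "\<dots> = exp (worst_mean mb mf v + variance_proxy \<sigma>f \<sigma>b v / 2)"
    by (simp add: worst_mean_def variance_proxy_def sum.distrib sum_divide_distrib flip: exp_sum)
  finally show "(\<integral>u. exp (v \<bullet> u) \<partial>P) \<le> exp (worst_mean mb mf v + variance_proxy \<sigma>f \<sigma>b v / 2)" .
qed

section \<open>The probabilistic guarantee\<close>

text \<open>Chernoff's bound at threshold \<open>M + a\<close> with \<open>a = sqrt (2 * L * V)\<close> is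
  \<open>exp (l\<^sup>2 * V / 2 - l * a)\<close>; the multiplier \<open>l = a / V\<close> minimizes the exponent, with value
  \<open>- a\<^sup>2 / (2 * V) = - L\<close>.\<close>

lemma prob_linear_form_ge:
  fixes P :: "(real^'d) measure"
  assumes ind: "independent_components P"
    and P: "P \<in> P_FB mb mf \<sigma>f \<sigma>b"
    and \<sigma>: "\<And>i. 0 < \<sigma>f $ i" "\<And>i. 0 < \<sigma>b $ i"
    and \<epsilon>: "0 < \<epsilon>" "\<epsilon> < 1" and "v \<noteq> 0"
  shows "measure P {u \<in> space P. FB_support_value mb mf \<sigma>f \<sigma>b \<epsilon> v \<le> v \<bullet> u} \<le> \<epsilon>"
proof -
  interpret prob_space P
    using P by (simp add: P_FB_def)
  let ?L = "ln (1 / \<epsilon>)" and ?M = "worst_mean mb mf v" and ?V = "variance_proxy \<sigma>f \<sigma>b v"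
  define a where "a = sqrt (2 * ?L * ?V)"
  define l where "l = a / ?V"
  have L: "0 < ?L"
    using \<epsilon> by simp
  have V: "0 < ?V"
    using variance_proxy_pos \<sigma> \<open>v \<noteq> 0\<close> by blast
  have a: "0 < a" "a\<^sup>2 = 2 * ?L * ?V"
    using L V by (simp_all add: a_def)
  have l: "0 < l"
    using a V by (simp add: l_def)
  note mgf = mgf_linear_form_le[OF ind P, of "l *\<^sub>R v"]
  have "{u \<in> space P. FB_support_value mb mf \<sigma>f \<sigma>b \<epsilon> v \<le> v \<bullet> u} =
        {u \<in> space P. exp (l * (?M + a)) \<le> exp ((l *\<^sub>R v) \<bullet> u)}"
    using l by (simp add: FB_support_value_def a_def)
  also have "measure P \<dots> \<le> (\<integral>u. exp ((l *\<^sub>R v) \<bullet> u) \<partial>P) / exp (l * (?M + a))"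
    using mgf(1) by (intro integral_Markov_inequality_measure[where A = "{}"]) auto
  also have "\<dots> \<le> exp (l * ?M + l\<^sup>2 * ?V / 2) / exp (l * (?M + a))"
    using mgf(2) l by (intro divide_right_mono) (simp_all add: worst_mean_scaleR variance_proxy_scaleR)
  also have "\<dots> = exp (l\<^sup>2 * ?V / 2 - l * a)"
    by (simp add: algebra_simps flip: exp_diff)
  also have "l\<^sup>2 * ?V / 2 - l * a = - (a\<^sup>2) / (2 * ?V)"
    using V by (simp add: l_def field_simps power2_eq_square)
  also have "\<dots> = - ?L"
    using V by (simp add: a(2))
  also have "exp (- ?L) = \<epsilon>"
    using \<epsilon> by (simp add: ln_div)
  finally show ?thesis .
qed

text \<open>A separating hyperplane reduces the concave constraint to the linear form of the previous
  lemma, with a threshold at least the support function because the latter is attained.\<close>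

lemma guarantee_U_FB:
  fixes P :: "(real^'d) measure"
  assumes ind: "independent_components P"
    and P: "P \<in> P_FB mb mf \<sigma>f \<sigma>b"
    and \<sigma>: "\<And>i. 0 < \<sigma>f $ i" "\<And>i. 0 < \<sigma>b $ i"
    and m: "\<And>i. mb $ i \<le> mf $ i"
    and \<epsilon>: "0 < \<epsilon>" "\<epsilon> < 1"
  shows "implies_guarantee K P \<epsilon> (U_FB mb mf \<sigma>f \<sigma>b \<epsilon>)"
  unfolding implies_guarantee_def
proof (intro allI impI)
  fix x0 :: "real^'k" and f :: "real^'d \<Rightarrow> real^'k \<Rightarrow> real"
  assume conc: "\<forall>x. concave_on UNIV (\<lambda>u. f u x)" and le0: "\<forall>u\<in>U_FB mb mf \<sigma>f \<sigma>b \<epsilon>. f u x0 \<le> 0"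
  interpret prob_space P
    using P by (simp add: P_FB_def)
  have sets_P: "sets P = sets borel"
    using P by (simp add: P_FB_def)
  have space_P: "space P = UNIV"
    using sets_eq_imp_space_eq[OF sets_P] by simp
  define C where "C = {u. 0 < f u x0}"
  have conc0: "concave_on UNIV (\<lambda>u. f u x0)"
    using conc by blast
  have "convex_on UNIV (\<lambda>u. - f u x0)"
    using conc0 by (simp add: concave_on_def)
  then have "continuous_on UNIV (\<lambda>u. - f u x0)"
    by (rule convex_on_continuous[OF open_UNIV])
  then have "continuous_on UNIV (\<lambda>u. f u x0)"
    using continuous_on_minus by fastforce
  then have "open C"
    unfolding C_def by (intro open_Collect_less continuous_on_const)
  then have C_sets: "C \<in> events"
    by (simp add: sets_P)
  have "measure P C \<le> \<epsilon>"
  proof (cases "C = {}")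
    case True
    then show ?thesis
      using \<epsilon> by simp
  next
    case False
    have "convex C"
    proof (rule convexI)
      fix u w p q assume u: "u \<in> C" "w \<in> C" and pq: "0 \<le> p" "0 \<le> q" "p + q = (1::real)"
      have "0 < p * f u x0 + q * f w x0"
        using u convex_bound_lt[of "- f u x0" 0 "- f w x0" p q] pq by (simp add: C_def)
      also have "\<dots> \<le> f (p *\<^sub>R u + q *\<^sub>R w) x0"
        using conc0 pq by (simp add: concave_on_iff)
      finally show "p *\<^sub>R u + q *\<^sub>R w \<in> C"
        by (simp add: C_def)
    qed
    moreover have "U_FB mb mf \<sigma>f \<sigma>b \<epsilon> \<noteq> {}"
      using U_FB_maximizer[OF \<sigma> m \<epsilon>] by blast
    moreover have "U_FB mb mf \<sigma>f \<sigma>b \<epsilon> \<inter> C = {}"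
      using le0 by (force simp: C_def)
    ultimately obtain v b where v: "v \<noteq> 0"
      and U_le: "\<forall>u\<in>U_FB mb mf \<sigma>f \<sigma>b \<epsilon>. v \<bullet> u \<le> b" and C_ge: "\<forall>u\<in>C. b \<le> v \<bullet> u"
      using separating_hyperplane_sets[OF convex_U_FB] False by metis
    obtain u0 where "u0 \<in> U_FB mb mf \<sigma>f \<sigma>b \<epsilon>" "v \<bullet> u0 = FB_support_value mb mf \<sigma>f \<sigma>b \<epsilon> v"
      using U_FB_maximizer[OF \<sigma> m \<epsilon>] by blast
    then have "FB_support_value mb mf \<sigma>f \<sigma>b \<epsilon> v \<le> b"
      using U_le by metis
    then have "C \<subseteq> {u \<in> space P. FB_support_value mb mf \<sigma>f \<sigma>b \<epsilon> v \<le> v \<bullet> u}"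
      using C_ge space_P by fastforce
    moreover have "{u \<in> space P. FB_support_value mb mf \<sigma>f \<sigma>b \<epsilon> v \<le> v \<bullet> u} \<in> events"
      by (simp add: sets_P space_P borel_closed closed_halfspace_ge)
    ultimately have "measure P C \<le> measure P {u \<in> space P. FB_support_value mb mf \<sigma>f \<sigma>b \<epsilon> v \<le> v \<bullet> u}"
      by (rule finite_measure_mono)
    also have "\<dots> \<le> \<epsilon>"
      using prob_linear_form_ge[OF ind P \<sigma> \<epsilon> v] .
    finally show ?thesis .
  qed
  moreover have "{u \<in> space P. f u x0 \<le> 0} = space P - C"
    by (auto simp: C_def)
  ultimately show "1 - \<epsilon> \<le> measure P {u \<in> space P. f u x0 \<le> 0}"
    using prob_compl[OF C_sets] by simp
qed

theorem theorem6:
  fixes P :: "(real^'d) measure"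
    and N :: nat
    and \<alpha> :: real
    and t \<sigma>f \<sigma>b :: "(nat \<Rightarrow> real^'d) \<Rightarrow> real^'d"
  defines "mb \<equiv> \<lambda>S. sample_mean N S - t S"
    and "mf \<equiv> \<lambda>S. sample_mean N S + t S"
  assumes "0 < \<alpha>" "\<alpha> < 1" "0 < N"
    and "prob_space P" "sets P = sets borel"
    and "independent_components P"
    and "bounded (measure_support P)"
    and "\<And>S i. S \<in> space (sample_measure P N) \<Longrightarrow> 0 \<le> t S $ i"
    and "\<And>S i. S \<in> space (sample_measure P N) \<Longrightarrow> 0 < \<sigma>f S $ i"
    and "\<And>S i. S \<in> space (sample_measure P N) \<Longrightarrow> 0 < \<sigma>b S $ i"
    and "with_prob_at_least (sample_measure P N) (1 - \<alpha>)
           (\<lambda>S. P \<in> P_FB (mb S) (mf S) (\<sigma>f S) (\<sigma>b S))"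
  shows "with_prob_at_least (sample_measure P N) (1 - \<alpha>)
           (\<lambda>S. simultaneously_implies_guarantee TYPE('k::finite) P
                  (U_FB (mb S) (mf S) (\<sigma>f S) (\<sigma>b S)))
       \<and> (\<forall>S \<in> space (sample_measure P N). \<forall>\<epsilon> v. 0 < \<epsilon> \<and> \<epsilon> < 1 \<longrightarrow>
            support_function v (U_FB (mb S) (mf S) (\<sigma>f S) (\<sigma>b S) \<epsilon>) =
            ereal ((\<Sum>i | 0 \<le> v $ i. mf S $ i * v $ i) + (\<Sum>i | v $ i < 0. mb S $ i * v $ i) +
                   sqrt (2 * ln (1 / \<epsilon>) *
                     ((\<Sum>i | 0 \<le> v $ i. (\<sigma>f S $ i)\<^sup>2 * (v $ i)\<^sup>2) +
                      (\<Sum>i | v $ i < 0. (\<sigma>b S $ i)\<^sup>2 * (v $ i)\<^sup>2)))))"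
proof -
  have m: "mb S $ i \<le> mf S $ i" if "S \<in> space (sample_measure P N)" for S i
    using assms(10)[OF that, of i] by (simp add: mb_def mf_def)
  obtain A where A: "A \<in> sets (sample_measure P N)" "1 - \<alpha> \<le> measure (sample_measure P N) A"
    and pass: "\<And>S. S \<in> A \<Longrightarrow> P \<in> P_FB (mb S) (mf S) (\<sigma>f S) (\<sigma>b S)"
    using assms(13) unfolding with_prob_at_least_def by blast
  have "simultaneously_implies_guarantee TYPE('k) P (U_FB (mb S) (mf S) (\<sigma>f S) (\<sigma>b S))"
    if "S \<in> A" for S
  proof -
    have S: "S \<in> space (sample_measure P N)"
      using sets.sets_into_space[OF A(1)] that by blast
    show ?thesis
      unfolding simultaneously_implies_guarantee_def
      using guarantee_U_FB[OF assms(8) pass[OF that] assms(11)[OF S] assms(12)[OF S] m[OF S]]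
      by blast
  qed
  then show ?thesis
    using A support_function_U_FB[OF assms(11) assms(12) m]
    unfolding with_prob_at_least_def FB_support_value_eq by blast
qed

end
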